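(* Let $H$ be a nontrivial complex Hilbert space and let $L:H\to H$ be an invertible bounded linear operator with bounded inverse. If $L$ is normal (i.e. $L$ commutes with its adjoint) and has the topological shadowing property, then $\Omega(L)=\{0\}$.
   Context: The nonwandering set $\Omega(L)$ is the set of those $x\in H$ such that for every neighborhood $U$ of $x$ there is an integer $n\geq 1$ with $L^n(U)\cap U\neq\emptyset$. "Nontrivial" means of positive dimension. For a metric space $Y$, $C^+(Y)$ denotes the set of all continuous functions $\delta:Y\to(0,\infty)$. Let $f:Y\to Y$ be a bijective map. For $\delta\in C^+(Y)$, a sequence $(x_n)_{n\in\mathbb{Z}}$ in $Y$ is a $\delta$-pseudo orbit of $f$ if $d(f(x_n),x_{n+1})<\delta(f(x_n))$ for all $n\in\mathbb{Z}$; it can be $\delta$-shadowed if there is $x\in Y$ such that $d(f^n(x),x_n)<\delta(f^n(x))$ for all $n\in\mathbb{Z}$. The map $f$ has the topological shadowing property if for every $\epsilon\in C^+(Y)$ there exists $\delta\in C^+(Y)$ such that every $\delta$-pseudo orbit of $f$ can be $\epsilon$-shadowed. A Hilbert space is regarded as a metric space with the metric induced by its norm. *)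

theory Defs
  imports "HOL-Analysis.Analysis"
begin

class complex_vector = real_vector +
  fixes scaleC :: "complex \<Rightarrow> 'a \<Rightarrow> 'a"  (infixr \<open>*\<^sub>C\<close> 75)
  assumes scaleC_add_right: "c *\<^sub>C (x + y) = c *\<^sub>C x + c *\<^sub>C y"
    and scaleC_add_left: "(b + c) *\<^sub>C x = b *\<^sub>C x + c *\<^sub>C x"
    and scaleC_scaleC: "b *\<^sub>C c *\<^sub>C x = (b * c) *\<^sub>C x"
    and scaleR_scaleC: "r *\<^sub>R x = complex_of_real r *\<^sub>C x"

text \<open>The inner product is linear in its first argument. The norm, and with it the metric and
  the topology of the superclasses, is the one induced by the inner product.\<close>

class complex_inner = complex_vector + real_normed_vector +
  fixes cinner :: "'a \<Rightarrow> 'a \<Rightarrow> complex"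
  assumes cinner_commute: "cinner x y = cnj (cinner y x)"
    and cinner_add_left: "cinner (x + y) z = cinner x z + cinner y z"
    and cinner_scaleC_left: "cinner (c *\<^sub>C x) y = c * cinner x y"
    and cinner_ge_zero: "0 \<le> Re (cinner x x)"
    and cinner_eq_zero_iff: "cinner x x = 0 \<longleftrightarrow> x = 0"
    and norm_eq_sqrt_cinner: "norm x = sqrt (Re (cinner x x))"

class complex_hilbert_space = complex_inner + complete_space

text \<open>The class is inhabited by the one-dimensional space.\<close>

instantiation complex :: complex_hilbert_space
begin

definition scaleC_complex :: "complex \<Rightarrow> complex \<Rightarrow> complex"
  where "scaleC_complex c x = c * x"

definition cinner_complex :: "complex \<Rightarrow> complex \<Rightarrow> complex"
  where "cinner_complex x y = x * cnj y"

instance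
proof
  fix b c x y z :: complex and r :: real
  show "c *\<^sub>C (x + y) = c *\<^sub>C x + c *\<^sub>C y" "(b + c) *\<^sub>C x = b *\<^sub>C x + c *\<^sub>C x"
    "b *\<^sub>C c *\<^sub>C x = (b * c) *\<^sub>C x" "r *\<^sub>R x = complex_of_real r *\<^sub>C x"
    by (simp_all add: scaleC_complex_def algebra_simps scaleR_conv_of_real)
  show "cinner x y = cnj (cinner y x)" "cinner (x + y) z = cinner x z + cinner y z"
    "cinner (c *\<^sub>C x) y = c * cinner x y" "0 \<le> Re (cinner x x)" "cinner x x = 0 \<longleftrightarrow> x = 0"
    by (simp_all add: scaleC_complex_def cinner_complex_def algebra_simps)
  show "norm x = sqrt (Re (cinner x x))"
    by (simp add: cinner_complex_def cmod_def power2_eq_square)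
qed

end

definition bounded_clinear :: "('a::complex_inner \<Rightarrow> 'b::complex_inner) \<Rightarrow> bool"
  where "bounded_clinear L \<longleftrightarrow> bounded_linear L \<and> (\<forall>c x. L (c *\<^sub>C x) = c *\<^sub>C L x)"

text \<open>As for the library's \<^const>\<open>adjoint\<close>, the characterising property determines the map
  uniquely; for a bounded complex-linear operator between Hilbert spaces such a map exists by the
  Riesz representation theorem.\<close>

definition cadjoint :: "('a::complex_inner \<Rightarrow> 'b::complex_inner) \<Rightarrow> 'b \<Rightarrow> 'a"
  where "cadjoint L = (SOME M. \<forall>x y. cinner (L x) y = cinner x (M y))"

definition normal_operator :: "('a::complex_inner \<Rightarrow> 'a) \<Rightarrow> bool"
  where "normal_operator L \<longleftrightarrow> L \<circ> cadjoint L = cadjoint L \<circ> L"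

definition nonwandering_set :: "('a::topological_space \<Rightarrow> 'a) \<Rightarrow> 'a set"
  where "nonwandering_set f =
    {x. \<forall>U. open U \<and> x \<in> U \<longrightarrow> (\<exists>n\<ge>1. (f ^^ n) ` U \<inter> U \<noteq> {})}"

definition pos_continuous :: "('a::topological_space \<Rightarrow> real) set"
  where "pos_continuous = {\<delta>. continuous_on UNIV \<delta> \<and> (\<forall>x. 0 < \<delta> x)}"

text \<open>Integer iterates; meaningful for bijective maps only.\<close>

definition int_iterate :: "('a \<Rightarrow> 'a) \<Rightarrow> int \<Rightarrow> 'a \<Rightarrow> 'a"
  where "int_iterate f n = (if 0 \<le> n then f ^^ nat n else inv f ^^ nat (- n))"

definition pseudo_orbit :: "('a::metric_space \<Rightarrow> 'a) \<Rightarrow> ('a \<Rightarrow> real) \<Rightarrow> (int \<Rightarrow> 'a) \<Rightarrow> bool"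
  where "pseudo_orbit f \<delta> x \<longleftrightarrow> (\<forall>n. dist (f (x n)) (x (n + 1)) < \<delta> (f (x n)))"

definition shadowed :: "('a::metric_space \<Rightarrow> 'a) \<Rightarrow> ('a \<Rightarrow> real) \<Rightarrow> (int \<Rightarrow> 'a) \<Rightarrow> bool"
  where "shadowed f \<epsilon> x \<longleftrightarrow>
    (\<exists>y. \<forall>n. dist (int_iterate f n y) (x n) < \<epsilon> (int_iterate f n y))"

definition topological_shadowing :: "('a::metric_space \<Rightarrow> 'a) \<Rightarrow> bool"
  where "topological_shadowing f \<longleftrightarrow>
    (\<forall>\<epsilon>\<in>pos_continuous. \<exists>\<delta>\<in>pos_continuous. \<forall>x. pseudo_orbit f \<delta> x \<longrightarrow> shadowed f \<epsilon> x)"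

end

theory Submission imports Defs begin

text \<open>
  The theorem rests on a Lyapunov function and on a conserved pairing. Write \<open>T\<close> for the positive
  operator \<open>L\<^sup>* L\<close>, which commutes with \<open>L\<close> because \<open>L\<close> is normal.

  The quadratic form \<open>V y = \<parallel>L y\<parallel>\<^sup>2 - \<parallel>y\<parallel>\<^sup>2\<close> is a Lyapunov function: normality gives
  \<open>V (L y) - V y = \<parallel>T y - y\<parallel>\<^sup>2\<close>. Along a return of a neighbourhood of a nonwandering point \<open>x\<close> the
  form \<open>V\<close> can only grow, and by at least \<open>\<parallel>T y - y\<parallel>\<^sup>2\<close>, while it starts and ends near \<open>V x\<close>.
  Hence \<open>T x = x\<close> (\<open>nonwandering_imp_adjoint_comp_fixes\<close>). For such a vector the numbers
  \<open>\<langle>L\<^sup>n y, L\<^sup>n x\<rangle>\<close> do not depend on \<open>n\<close>, whatever \<open>y\<close> is (\<open>unitary_part\<close>). One consequence is that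
  \<open>x\<close> is recurrent, that is, \<open>L\<^sup>n x\<close> comes back arbitrarily close to \<open>x\<close>
  (\<open>nonwandering_unitary_imp_recurrent\<close>).

  A nonzero recurrent vector \<open>x\<close> of this kind contradicts shadowing
  (\<open>no_shadowing_if_recurrent_unitary\<close>). Given \<open>\<delta>\<close>, consider \<open>c\<^sub>m L\<^sup>m x\<close>, where \<open>c\<^sub>m\<close> climbs from \<open>1\<close>
  to \<open>2\<close> in \<open>K\<close> equal steps, one at each of the times \<open>n, 2n, \<dots>, Kn\<close>. If \<open>n\<close> is a good enough
  return time, all jumps take place near the compact segment from \<open>x\<close> to \<open>2x\<close>, on a neighbourhood
  of which \<open>\<delta>\<close> is bounded below, so for large \<open>K\<close> this is a \<open>\<delta>\<close>-pseudo orbit. Recurrence is what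
  places the jumps near a compact set; this matters because balls need not be compact, and \<open>\<delta>\<close>
  may have infimum zero along the orbit. If \<open>y\<close> traced it closely, the constant \<open>\<langle>y, x\<rangle> = \<langle>L\<^sup>m y, L\<^sup>m x\<rangle>\<close>
  would be close to \<open>c\<^sub>m \<parallel>x\<parallel>\<^sup>2\<close> both for \<open>c\<^sub>m = 1\<close> and for \<open>c\<^sub>m = 2\<close>, which is absurd.
\<close>

section \<open>Complex inner products\<close>

lemma cinner_add_right: "cinner x (y + z) = cinner x y + cinner x (z::'a::complex_inner)"
  by (metis cinner_add_left cinner_commute complex_cnj_add)

lemma cinner_scaleR_left: "cinner (r *\<^sub>R x) y = of_real r * cinner x (y::'a::complex_inner)"
  by (simp add: scaleR_scaleC cinner_scaleC_left)

lemma cinner_scaleR_right: "cinner x (r *\<^sub>R y) = of_real r * cinner x (y::'a::complex_inner)"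
  by (metis cinner_commute cinner_scaleR_left complex_cnj_complex_of_real complex_cnj_mult)

lemma cinner_minus_left: "cinner (- x) y = - cinner x (y::'a::complex_inner)"
  using cinner_scaleR_left[of "-1" x y] by simp

lemma cinner_minus_right: "cinner x (- y) = - cinner x (y::'a::complex_inner)"
  using cinner_scaleR_right[of x "-1" y] by simp

lemma cinner_diff_left: "cinner (x - y) z = cinner x z - cinner y (z::'a::complex_inner)"
  using cinner_add_left[of x "- y" z] by (simp add: cinner_minus_left)

lemma cinner_diff_right: "cinner x (y - z) = cinner x y - cinner x (z::'a::complex_inner)"
  using cinner_add_right[of x y "- z"] by (simp add: cinner_minus_right)

lemma Re_cinner_commute: "Re (cinner x y) = Re (cinner y (x::'a::complex_inner))"
  by (subst cinner_commute) simp

lemma Re_cinner_self: "Re (cinner x x) = (norm (x::'a::complex_inner))\<^sup>2"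
  by (simp add: norm_eq_sqrt_cinner cinner_ge_zero)

lemma norm_add_sq:
  "(norm (x + y))\<^sup>2 = (norm x)\<^sup>2 + 2 * Re (cinner x y) + (norm (y::'a::complex_inner))\<^sup>2"
  by (simp add: Re_cinner_self[symmetric] cinner_add_left cinner_add_right Re_cinner_commute[of y x])

lemma norm_diff_sq:
  "(norm (x - y))\<^sup>2 = (norm x)\<^sup>2 - 2 * Re (cinner x y) + (norm (y::'a::complex_inner))\<^sup>2"
  by (simp add: Re_cinner_self[symmetric] cinner_diff_left cinner_diff_right Re_cinner_commute[of y x])

text \<open>The triangle inequality of the norm is part of the class, and squaring it yields the
  Cauchy-Schwarz inequality.\<close>

lemma Re_cinner_le: "Re (cinner x y) \<le> norm x * norm (y::'a::complex_inner)"
proof -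
  have "(norm (x + y))\<^sup>2 \<le> (norm x + norm y)\<^sup>2"
    by (intro power_mono norm_triangle_ineq) auto
  then show ?thesis
    unfolding norm_add_sq by (simp add: power2_sum)
qed

lemma abs_Re_cinner_le: "\<bar>Re (cinner x y)\<bar> \<le> norm x * norm (y::'a::complex_inner)"
  using Re_cinner_le[of x y] Re_cinner_le[of "- x" y] by (auto simp: cinner_minus_left abs_le_iff)

lemma bounded_linear_Re_cinner: "bounded_linear (\<lambda>x. Re (cinner x (y::'a::complex_inner)))"
  by (rule bounded_linear_intro[where K = "norm y"])
     (auto simp: cinner_add_left cinner_scaleR_left abs_Re_cinner_le)

section \<open>Existence of the adjoint\<close>

text \<open>The representing vector is the minimiser of \<open>\<parallel>z\<parallel>\<^sup>2 - 2 f z\<close>. By the parallelogram law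
  minimising sequences are Cauchy, and a minimiser has vanishing derivative in every direction.\<close>

lemma riesz_representation_real:
  fixes f :: "'a::complex_hilbert_space \<Rightarrow> real"
  assumes f: "bounded_linear f"
  shows "\<exists>z. \<forall>h. f h = Re (cinner h z)"
proof -
  interpret f: bounded_linear f by fact
  define J where "J z = (norm z)\<^sup>2 - 2 * f z" for z
  obtain B where B: "\<And>z. norm (f z) \<le> norm z * B" using f.bounded by blast
  have J_lower: "- B\<^sup>2 \<le> J z" for z
  proof -
    have "0 \<le> (norm z - B)\<^sup>2" by simp
    moreover have "f z \<le> norm z * B" using B[of z] by simp
    ultimately show ?thesis by (simp add: J_def power2_diff)
  qed
  then have bdd: "bdd_below (range J)" by (auto intro!: bdd_belowI)
  define m where "m = Inf (range J)"
  have m_le: "m \<le> J z" for z unfolding m_def by (rule cInf_lower[OF _ bdd]) simp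
  have "\<exists>z. J z < m + 1 / real (Suc n)" for n
  proof -
    have "Inf (range J) < m + 1 / real (Suc n)" by (simp add: m_def)
    then show ?thesis by (subst (asm) cInf_less_iff[OF _ bdd]) auto
  qed
  then obtain Z where Z: "\<And>n. J (Z n) < m + 1 / real (Suc n)" by metis
  have midpoint: "(norm (a - b))\<^sup>2 = 2 * J a + 2 * J b - 4 * J ((1/2) *\<^sub>R (a + b))" for a b
  proof -
    have "J ((1/2) *\<^sub>R (a + b)) = (norm (a + b))\<^sup>2 / 4 - (f a + f b)"
      unfolding J_def by (simp only: f.scaleR f.add norm_scaleR power_mult_distrib) (simp add: power2_eq_square add_divide_distrib)
    moreover have "(norm (a - b))\<^sup>2 = 2 * (norm a)\<^sup>2 + 2 * (norm b)\<^sup>2 - (norm (a + b))\<^sup>2"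
      by (simp add: norm_add_sq norm_diff_sq)
    ultimately show ?thesis by (simp add: J_def)
  qed
  have close: "(norm (Z i - Z j))\<^sup>2 \<le> 4 / real (Suc N)" if "N \<le> i" "N \<le> j" for i j N
  proof -
    have "1 / real (Suc i) \<le> 1 / real (Suc N)" "1 / real (Suc j) \<le> 1 / real (Suc N)"
      using that by (auto simp: frac_le)
    then show ?thesis
      using midpoint[of "Z i" "Z j"] Z[of i] Z[of j] m_le[of "(1/2) *\<^sub>R (Z i + Z j)"] by linarith
  qed
  have "Cauchy Z"
  proof (rule metric_CauchyI)
    fix e :: real assume "0 < e"
    then obtain N where "inverse (real (Suc N)) < e\<^sup>2 / 4"
      using reals_Archimedean[of "e\<^sup>2 / 4"] by auto
    then have N: "4 / real (Suc N) < e\<^sup>2" by (simp add: field_simps)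
    have "dist (Z i) (Z j) < e" if "N \<le> i" "N \<le> j" for i j
      using close[OF that] N \<open>0 < e\<close> unfolding dist_norm
      by (meson le_less_trans less_imp_le power_less_imp_less_base)
    then show "\<exists>N. \<forall>i\<ge>N. \<forall>j\<ge>N. dist (Z i) (Z j) < e" by blast
  qed
  then obtain z where z: "Z \<longlonglongrightarrow> z" using Cauchy_convergent convergent_def by blast
  have "(\<lambda>n. J (Z n)) \<longlonglongrightarrow> J z"
    unfolding J_def by (intro tendsto_intros f.tendsto z)
  moreover have "(\<lambda>n. m + 1 / real (Suc n)) \<longlonglongrightarrow> m + 0"
    by (intro tendsto_add tendsto_const) (use LIMSEQ_inverse_real_of_nat in \<open>simp add: inverse_eq_divide\<close>)
  ultimately have "J z \<le> m + 0"
    by (rule LIMSEQ_le) (use Z in \<open>auto intro: less_imp_le\<close>)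
  then have min: "J z \<le> J w" for w using m_le[of w] by simp
  have "f h = Re (cinner h z)" for h
  proof (cases "h = 0")
    case True
    then show ?thesis using cinner_scaleR_left[of 0 h z] by (simp add: f.zero)
  next
    case False
    define b where "b = Re (cinner h z) - f h"
    have quad: "0 \<le> t\<^sup>2 * (norm h)\<^sup>2 + 2 * t * b" for t
      using min[of "z + t *\<^sub>R h"] unfolding J_def b_def
      by (simp add: norm_add_sq f.add f.scaleR cinner_scaleR_right Re_cinner_commute[of z h]
          power_mult_distrib algebra_simps)
    \<comment> \<open>The quadratic is evaluated at its vertex.\<close>
    from quad[of "- b / (norm h)\<^sup>2"] False have "b\<^sup>2 \<le> 0"
      by (simp add: field_simps power2_eq_square)
    then show ?thesis by (simp add: b_def)
  qed
  then show ?thesis by blast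
qed

lemma cinner_cadjoint:
  fixes L :: "'a::complex_hilbert_space \<Rightarrow> 'b::complex_inner"
  assumes L: "bounded_clinear L"
  shows "cinner (L x) y = cinner x (cadjoint L y)"
proof -
  have "\<exists>z. \<forall>x. cinner (L x) y = cinner x z" for y
  proof -
    have "bounded_linear (\<lambda>x. Re (cinner (L x) y))"
      using L unfolding bounded_clinear_def
      by (intro bounded_linear_compose[OF bounded_linear_Re_cinner]) blast
    from riesz_representation_real[OF this]
    obtain z where z: "\<And>x. Re (cinner (L x) y) = Re (cinner x z)" by blast
    \<comment> \<open>Complex linearity turns the real part at \<open>\<i> x\<close> into the imaginary part at \<open>x\<close>.\<close>
    have "Im (cinner (L x) y) = Im (cinner x z)" for x
      using z[of "\<i> *\<^sub>C x"] L by (simp add: bounded_clinear_def cinner_scaleC_left)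
    with z show ?thesis by (auto simp: complex_eq_iff)
  qed
  then have "\<exists>M. \<forall>x y. cinner (L x) y = cinner x (M y)" by metis
  then show ?thesis unfolding cadjoint_def by (rule someI2_ex) blast
qed

section \<open>The Lyapunov function of a normal operator\<close>

text \<open>The second difference of \<open>n \<mapsto> \<parallel>L\<^sup>n y\<parallel>\<^sup>2\<close> is the square of \<open>\<parallel>L\<^sup>* L y - y\<parallel>\<close>, since normality
  rewrites \<open>\<parallel>L (L y)\<parallel>\<^sup>2\<close> as \<open>\<parallel>L\<^sup>* L y\<parallel>\<^sup>2\<close>.\<close>

lemma normal_second_difference:
  fixes L :: "'a::complex_hilbert_space \<Rightarrow> 'a"
  assumes L: "bounded_clinear L" and normal: "normal_operator L"
  shows "(norm (L (L y)))\<^sup>2 - 2 * (norm (L y))\<^sup>2 + (norm y)\<^sup>2 = (norm (cadjoint L (L y) - y))\<^sup>2"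
proof -
  let ?T = "\<lambda>y. cadjoint L (L y)"
  have "cadjoint L (L (L y)) = L (?T y)"
    using normal unfolding normal_operator_def by (metis comp_apply)
  then have "Re (cinner (L (L y)) (L (L y))) = Re (cinner (L y) (L (?T y)))"
    by (simp add: cinner_cadjoint[OF L])
  also have "\<dots> = Re (cinner (L (?T y)) (L y))" by (rule Re_cinner_commute)
  also have "\<dots> = (norm (?T y))\<^sup>2" by (simp add: cinner_cadjoint[OF L] Re_cinner_self)
  finally have "(norm (L (L y)))\<^sup>2 = (norm (?T y))\<^sup>2" by (simp add: Re_cinner_self)
  moreover have "(norm (L y))\<^sup>2 = Re (cinner (?T y) y)"
    by (metis Re_cinner_self Re_cinner_commute cinner_cadjoint[OF L])
  ultimately show ?thesis by (simp add: norm_diff_sq)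
qed

definition norm_growth :: "('a::real_normed_vector \<Rightarrow> 'a) \<Rightarrow> 'a \<Rightarrow> real"
  where "norm_growth L y = (norm (L y))\<^sup>2 - (norm y)\<^sup>2"

text \<open>The gain of the first step already is the second difference at \<open>y\<close>, and later steps lose
  nothing. The bound is written with norms instead of the adjoint so that its continuity in \<open>y\<close>
  is evident.\<close>

lemma norm_growth_iterate:
  fixes L :: "'a::complex_hilbert_space \<Rightarrow> 'a"
  assumes L: "bounded_clinear L" and normal: "normal_operator L" and n: "1 \<le> n"
  shows "norm_growth L y + (norm (L (L y)))\<^sup>2 - 2 * (norm (L y))\<^sup>2 + (norm y)\<^sup>2
    \<le> norm_growth L ((L ^^ n) y)"
  using n
proof (induction n rule: nat_induct_at_least)
  case base
  then show ?case by (simp add: norm_growth_def)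
next
  case (Suc n)
  have "norm_growth L (L v) - norm_growth L v = (norm (cadjoint L (L v) - v))\<^sup>2" for v
    using normal_second_difference[OF L normal, of v] by (simp add: norm_growth_def)
  then have "norm_growth L ((L ^^ n) y) \<le> norm_growth L ((L ^^ Suc n) y)"
    by (smt (verit) funpow.simps(2) comp_apply zero_le_power2)
  with Suc show ?case by linarith
qed

lemma nonwandering_return:
  fixes f :: "'a::metric_space \<Rightarrow> 'a"
  assumes "x \<in> nonwandering_set f" and "0 < e"
  obtains n y where "1 \<le> n" "dist y x < e" "dist ((f ^^ n) y) x < e"
proof -
  have "open (ball x e)" "x \<in> ball x e" using assms(2) by auto
  with assms(1) obtain n where "1 \<le> n" "(f ^^ n) ` ball x e \<inter> ball x e \<noteq> {}"
    unfolding nonwandering_set_def by blast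
  then show ?thesis using that by (auto simp: dist_commute)
qed

text \<open>Between a start and a return that both tend to \<open>x\<close>, the Lyapunov function grows by at least
  the second difference at the start, so in the limit this second difference vanishes.\<close>

lemma nonwandering_imp_adjoint_comp_fixes:
  fixes L :: "'a::complex_hilbert_space \<Rightarrow> 'a"
  assumes L: "bounded_clinear L" and normal: "normal_operator L" and x: "x \<in> nonwandering_set L"
  shows "cadjoint L (L x) = x"
proof -
  interpret L: bounded_linear L using L by (simp add: bounded_clinear_def)
  have "\<exists>n y. 1 \<le> n \<and> dist y x < inverse (real (Suc k)) \<and> dist ((L ^^ n) y) x < inverse (real (Suc k))"
    for k by (rule nonwandering_return[OF x, of "inverse (real (Suc k))"]) auto
  then obtain n y where n: "\<And>k. 1 \<le> n k" and y: "\<And>k. dist (y k) x < inverse (real (Suc k))"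
    and z: "\<And>k. dist ((L ^^ n k) (y k)) x < inverse (real (Suc k))"
    by metis
  let ?z = "\<lambda>k. (L ^^ n k) (y k)"
  have lim: "u \<longlonglongrightarrow> x" if "\<And>k. dist (u k) x < inverse (real (Suc k))" for u :: "nat \<Rightarrow> 'a"
  proof -
    have "(\<lambda>k. dist (u k) x) \<longlonglongrightarrow> 0"
    proof (rule Lim_null_comparison[OF always_eventually LIMSEQ_inverse_real_of_nat], rule allI)
      show "norm (dist (u k) x) \<le> inverse (real (Suc k))" for k
        using less_imp_le[OF that[of k]] by (simp only: real_norm_def abs_of_nonneg zero_le_dist)
    qed
    then show ?thesis by (rule tendsto_dist_iff[THEN iffD2])
  qed
  have "y \<longlonglongrightarrow> x" "?z \<longlonglongrightarrow> x" by (rule lim, rule y, rule lim, rule z)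
  then have "(\<lambda>k. norm_growth L (y k) + (norm (L (L (y k))))\<^sup>2 - 2 * (norm (L (y k)))\<^sup>2 + (norm (y k))\<^sup>2)
      \<longlonglongrightarrow> norm_growth L x + (norm (L (L x)))\<^sup>2 - 2 * (norm (L x))\<^sup>2 + (norm x)\<^sup>2"
    and "(\<lambda>k. norm_growth L (?z k)) \<longlonglongrightarrow> norm_growth L x"
    unfolding norm_growth_def by (safe intro!: tendsto_intros L.tendsto)
  then have "norm_growth L x + (norm (L (L x)))\<^sup>2 - 2 * (norm (L x))\<^sup>2 + (norm x)\<^sup>2 \<le> norm_growth L x"
    by (rule LIMSEQ_le) (use norm_growth_iterate[OF L normal n] in blast)
  then have "(norm (cadjoint L (L x) - x))\<^sup>2 \<le> 0"
    using normal_second_difference[OF L normal, of x] by linarith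
  then show ?thesis by simp
qed

section \<open>The unitary part\<close>

text \<open>For a normal operator this is the kernel of \<open>L\<^sup>* L - 1\<close>. Pairing with such a vector plays the
  role of the orthogonal projection onto this kernel: it is conserved even if the other vector has
  components that \<open>L\<close> expands or contracts.\<close>

definition unitary_part :: "('a::complex_inner \<Rightarrow> 'a) \<Rightarrow> 'a set"
  where "unitary_part L = {x. \<forall>n y. cinner ((L ^^ n) y) ((L ^^ n) x) = cinner y x}"

lemma unitary_partD: "x \<in> unitary_part L \<Longrightarrow> cinner ((L ^^ n) y) ((L ^^ n) x) = cinner y x"
  by (simp add: unitary_part_def)

lemma norm_funpow_unitary:
  assumes "x \<in> unitary_part L"
  shows "norm ((L ^^ n) x) = norm x"
  using unitary_partD[OF assms, of n x] by (simp add: norm_eq_sqrt_cinner)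

lemma mem_unitary_part:
  fixes L :: "'a::complex_hilbert_space \<Rightarrow> 'a"
  assumes L: "bounded_clinear L" and normal: "normal_operator L" and x: "cadjoint L (L x) = x"
  shows "x \<in> unitary_part L"
proof -
  have fixed: "cadjoint L (L ((L ^^ n) x)) = (L ^^ n) x" for n
  proof (induction n)
    case (Suc n)
    have "cadjoint L (L (L ((L ^^ n) x))) = L (cadjoint L (L ((L ^^ n) x)))"
      using normal unfolding normal_operator_def by (metis comp_apply)
    with Suc show ?case by simp
  qed (simp add: x)
  have "cinner ((L ^^ n) y) ((L ^^ n) x) = cinner y x" for n y
  proof (induction n)
    case (Suc n)
    have "cinner (L ((L ^^ n) y)) (L ((L ^^ n) x)) = cinner ((L ^^ n) y) ((L ^^ n) x)"
      by (simp add: cinner_cadjoint[OF L] fixed)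
    with Suc show ?case by simp
  qed simp
  then show ?thesis by (simp add: unitary_part_def)
qed

text \<open>The point that returns is only near \<open>x\<close>, and \<open>L\<close> may expand the difference. Its pairing with
  the orbit of \<open>x\<close> is constant nevertheless, which makes the angle between \<open>L\<^sup>n x\<close> and \<open>x\<close> small.\<close>

lemma nonwandering_unitary_imp_recurrent:
  fixes L :: "'a::complex_inner \<Rightarrow> 'a"
  assumes x: "x \<in> nonwandering_set L" "x \<in> unitary_part L" and e: "0 < e"
  obtains n where "1 \<le> n" "norm ((L ^^ n) x - x) < e"
proof -
  define d where "d = e\<^sup>2 / (4 * (norm x + 1))"
  have pos: "0 < norm x + 1" by (simp add: add_nonneg_pos)
  have d: "0 < d" using e pos by (simp add: d_def)
  obtain n y where n: "1 \<le> n" and y: "dist y x < d" "dist ((L ^^ n) y) x < d"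
    by (rule nonwandering_return[OF x(1) d])
  let ?u = "(L ^^ n) x"
  have "Re (cinner ((L ^^ n) y - x) ?u) \<le> d * norm x"
    using Re_cinner_le[of "(L ^^ n) y - x" ?u] y(2) mult_right_mono[of "norm ((L ^^ n) y - x)" d "norm x"]
    by (simp add: norm_funpow_unitary[OF x(2)] dist_norm)
  moreover have "Re (cinner (x - y) x) \<le> d * norm x"
    using Re_cinner_le[of "x - y" x] y(1) mult_right_mono[of "norm (x - y)" d "norm x"]
    by (simp add: dist_norm norm_minus_commute)
  ultimately have "(norm x)\<^sup>2 - Re (cinner x ?u) \<le> 2 * (d * norm x)"
    by (simp add: cinner_diff_left unitary_partD[OF x(2)] Re_cinner_self)
  then have "(norm (?u - x))\<^sup>2 \<le> 4 * d * norm x"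
    by (simp add: norm_diff_sq norm_funpow_unitary[OF x(2)] Re_cinner_commute[of ?u x])
  also have "\<dots> < 4 * d * (norm x + 1)" using d by simp
  also have "\<dots> = e\<^sup>2" using pos unfolding d_def by (subst times_divide_eq_right) (simp add: field_simps)
  finally have "norm (?u - x) < e" using e by (meson less_imp_le power_less_imp_less_base)
  with n that show ?thesis by blast
qed

text \<open>Returns add up at most linearly, because \<open>L\<close> acts isometrically on the orbit of \<open>x\<close>.\<close>

lemma unitary_iterated_return:
  assumes x: "x \<in> unitary_part L"
  shows "norm ((L ^^ (k * n)) x - x) \<le> real k * norm ((L ^^ n) x - x)"
proof (induction k)
  case (Suc k)
  let ?j = "k * n"
  have "(norm ((L ^^ ?j) ((L ^^ n) x) - (L ^^ ?j) x))\<^sup>2 = (norm ((L ^^ n) x - x))\<^sup>2"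
    unfolding norm_diff_sq unitary_partD[OF x] norm_funpow_unitary[OF x]
    using norm_funpow_unitary[OF x, of "?j + n"] by (simp add: funpow_add norm_funpow_unitary[OF x])
  then have step: "norm ((L ^^ ?j) ((L ^^ n) x) - (L ^^ ?j) x) = norm ((L ^^ n) x - x)" by simp
  have "(L ^^ (Suc k * n)) x = (L ^^ ?j) ((L ^^ n) x)"
    by (simp add: funpow_add[symmetric, THEN fun_cong, simplified] add.commute)
  then have "norm ((L ^^ (Suc k * n)) x - x)
      \<le> norm ((L ^^ ?j) ((L ^^ n) x) - (L ^^ ?j) x) + norm ((L ^^ ?j) x - x)"
    using norm_triangle_ineq[of "(L ^^ ?j) ((L ^^ n) x) - (L ^^ ?j) x" "(L ^^ ?j) x - x"] by simp
  with step Suc show ?case by (simp add: algebra_simps)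
qed simp

section \<open>A drifting pseudo orbit\<close>

lemma int_iterate_of_nat: "int_iterate f (int n) = f ^^ n"
  by (simp add: int_iterate_def)

lemma int_iterate_succ:
  assumes "bij f"
  shows "f (int_iterate f m x) = int_iterate f (m + 1) x"
proof (cases "0 \<le> m")
  case True
  then show ?thesis by (simp add: int_iterate_def nat_add_distrib)
next
  case False
  then obtain k where "m = - int (Suc k)"
    by (metis int_cases of_nat_0_le_iff)
  moreover from this have "nat (- m) = Suc k" "nat (- (m + 1)) = k" by auto
  ultimately show ?thesis
    using assms by (cases k) (auto simp: int_iterate_def bij_is_surj surj_f_inv_f)
qed

text \<open>The factor that multiplies the orbit at time \<open>m\<close>: it rises from \<open>1\<close> to \<open>2\<close> by jumps of
  \<open>1 / K\<close> at the times \<open>n, 2n, \<dots>, Kn\<close>.\<close>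

definition staircase :: "nat \<Rightarrow> nat \<Rightarrow> int \<Rightarrow> real"
  where "staircase K n m = 1 + real_of_int (max 0 (min (int K) (m div int n))) / real K"

lemma staircase_bounds: "0 < K \<Longrightarrow> 1 \<le> staircase K n m \<and> staircase K n m \<le> 2"
  by (auto simp: staircase_def)

lemma staircase_step:
  assumes "0 < n" "0 < K"
  shows "staircase K n (m + 1) = staircase K n m \<or>
    (\<exists>k\<le>K. m + 1 = int (k * n) \<and> staircase K n (m + 1) = staircase K n m + 1 / real K)"
proof (cases "int n dvd m + 1")
  case False
  define q r where "q = (m + 1) div int n" and "r = (m + 1) mod int n"
  have "m + 1 = int n * q + r" by (simp add: q_def r_def)
  moreover have "0 \<le> r" "r < int n" using assms(1) by (simp_all add: r_def)
  moreover have "r \<noteq> 0" using False by (simp add: r_def dvd_eq_mod_eq_0)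
  ultimately have "m div int n = q" by (intro int_div_pos_eq[where r = "r - 1"]) auto
  then have "(m + 1) div int n = m div int n" by (simp add: q_def)
  then show ?thesis by (simp add: staircase_def)
next
  case True
  then obtain q where q: "m + 1 = int n * (q + 1)" by (metis dvd_def diff_add_cancel)
  then have "m = int n * q + (int n - 1)" by (simp add: algebra_simps)
  then have div: "m div int n = q" using assms(1) by (intro int_div_pos_eq) auto
  have div': "(m + 1) div int n = q + 1" using assms(1) q by simp
  show ?thesis
  proof (cases "0 \<le> q \<and> q < int K")
    case True
    then have "max 0 (min (int K) (q + 1)) = max 0 (min (int K) q) + 1" by auto
    then have "staircase K n (m + 1) = staircase K n m + 1 / real K"
      by (simp only: staircase_def div div') (simp add: add_divide_distrib)
    moreover have "m + 1 = int (nat (q + 1) * n)" "nat (q + 1) \<le> K" using q True by auto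
    ultimately show ?thesis by blast
  next
    case False
    then show ?thesis by (auto simp: staircase_def div div' max_def min_def)
  qed
qed

lemma positive_near_compact:
  fixes \<delta> :: "'a::metric_space \<Rightarrow> real"
  assumes "\<delta> \<in> pos_continuous" and S: "compact S" "S \<noteq> {}"
  obtains \<eta> e where "0 < \<eta>" "0 < e" "\<And>s y. s \<in> S \<Longrightarrow> dist s y < e \<Longrightarrow> \<eta> < \<delta> y"
proof -
  have cont: "continuous_on UNIV \<delta>" and pos: "\<And>y. 0 < \<delta> y"
    using assms(1) by (auto simp: pos_continuous_def)
  obtain s0 where s0: "s0 \<in> S" "\<And>s. s \<in> S \<Longrightarrow> \<delta> s0 \<le> \<delta> s"
    using continuous_attains_inf[OF S continuous_on_subset[OF cont]] by blast
  define W where "W = {y. \<delta> s0 / 2 < \<delta> y}"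
  have "open W" unfolding W_def by (intro open_Collect_less continuous_on_const cont)
  moreover have "S \<subseteq> W" using s0 pos[of s0] by (force simp: W_def)
  ultimately obtain e where "0 < e" "(\<Union>s\<in>S. ball s e) \<subseteq> W"
    using compact_subset_open_imp_ball_epsilon_subset[OF S(1)] by metis
  then show ?thesis
    using that[of "\<delta> s0 / 2" e] pos[of s0] by (auto simp: W_def subset_iff)
qed

lemma drifting_pseudo_orbit:
  fixes L :: "'a::complex_inner \<Rightarrow> 'a"
  assumes L: "bounded_clinear L" and bij: "bij L" and x: "x \<in> unitary_part L"
    and recurrent: "\<And>e. 0 < e \<Longrightarrow> \<exists>n\<ge>1. norm ((L ^^ n) x - x) < e"
    and \<delta>: "\<delta> \<in> pos_continuous"
  obtains K n where "0 < K" "0 < n"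
    "pseudo_orbit L \<delta> (\<lambda>m. staircase K n m *\<^sub>R int_iterate L m x)"
proof -
  interpret L: bounded_linear L using L by (simp add: bounded_clinear_def)
  let ?S = "(\<lambda>c. c *\<^sub>R x) ` {1..2}"
  have "compact ?S" by (intro compact_continuous_image continuous_intros) auto
  then obtain \<eta> e where \<eta>: "0 < \<eta>" and e: "0 < e"
    and near: "\<And>s y. s \<in> ?S \<Longrightarrow> dist s y < e \<Longrightarrow> \<eta> < \<delta> y"
    using positive_near_compact[OF \<delta>, of ?S] by auto
  obtain K where "norm x / \<eta> < real K" using reals_Archimedean2 by blast
  moreover have "0 \<le> norm x / \<eta>" using \<eta> by simp
  ultimately have K: "0 < K" by (auto intro: gr0I)
  with \<open>norm x / \<eta> < real K\<close> \<eta> have jump: "norm x / real K < \<eta>" by (simp add: field_simps)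
  \<comment> \<open>The number of jumps is settled before the return time, so that \<open>K\<close> successive returns may
    share the tolerance; a factor \<open>2\<close> accounts for the size of the staircase.\<close>
  obtain n where n: "1 \<le> n" "norm ((L ^^ n) x - x) < e / (2 * real K)"
    using recurrent[of "e / (2 * real K)"] e K by auto
  have ret: "norm ((L ^^ (k * n)) x - x) < e / 2" if "k \<le> K" for k
  proof -
    have "norm ((L ^^ (k * n)) x - x) \<le> real k * norm ((L ^^ n) x - x)"
      by (rule unitary_iterated_return[OF x])
    also have "\<dots> \<le> real K * norm ((L ^^ n) x - x)"
      using that by (simp add: mult_right_mono)
    also have "\<dots> < e / 2" using n(2) K by (simp add: field_simps)
    finally show ?thesis .
  qed
  let ?c = "staircase K n"
  have "dist (L (?c m *\<^sub>R int_iterate L m x)) (?c (m + 1) *\<^sub>R int_iterate L (m + 1) x)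
      < \<delta> (L (?c m *\<^sub>R int_iterate L m x))" for m
  proof -
    have image: "L (?c m *\<^sub>R int_iterate L m x) = ?c m *\<^sub>R int_iterate L (m + 1) x"
      by (simp add: L.scaleR int_iterate_succ[OF bij])
    have pos: "0 < \<delta> y" for y using \<delta> by (simp add: pos_continuous_def)
    from n(1) have "0 < n" by simp
    from staircase_step[OF this K, of m] show ?thesis
    proof (elim disjE exE conjE)
      assume "?c (m + 1) = ?c m"
      then show ?thesis by (simp add: image pos)
    next
      fix k assume k: "k \<le> K" "m + 1 = int (k * n)" and c: "?c (m + 1) = ?c m + 1 / real K"
      define v where "v = (L ^^ (k * n)) x"
      have v: "int_iterate L (m + 1) x = v" unfolding k(2) v_def int_iterate_of_nat ..
      have bounds: "1 \<le> ?c m" "?c m \<le> 2" using staircase_bounds[OF K] by auto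
      have "dist (?c m *\<^sub>R x) (?c m *\<^sub>R v) = ?c m * norm (v - x)"
        using bounds by (simp add: dist_norm norm_minus_commute flip: scaleR_diff_right)
      also have "\<dots> \<le> 2 * norm (v - x)" using bounds by (simp add: mult_right_mono)
      also have "\<dots> < e" using ret[OF k(1)] by (simp add: v_def)
      finally have "\<eta> < \<delta> (?c m *\<^sub>R v)" by (intro near[of "?c m *\<^sub>R x"]) (use bounds in auto)
      moreover have "dist (?c m *\<^sub>R v) (?c (m + 1) *\<^sub>R v) = norm x / real K"
        unfolding c by (simp add: dist_norm scaleR_add_left v_def norm_funpow_unitary[OF x])
      ultimately show ?thesis using jump unfolding image v by linarith
    qed
  qed
  then have "pseudo_orbit L \<delta> (\<lambda>m. ?c m *\<^sub>R int_iterate L m x)" by (simp add: pseudo_orbit_def)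
  then show ?thesis by (intro that[of K n]) (use K n(1) in auto)
qed

text \<open>An orbit that traces the drifting pseudo orbit has constant pairing with the orbit of \<open>x\<close>,
  whereas the pairing of the pseudo orbit doubles between time \<open>0\<close> and time \<open>K n\<close>.\<close>

lemma no_shadowing_if_recurrent_unitary:
  fixes L :: "'a::complex_inner \<Rightarrow> 'a"
  assumes L: "bounded_clinear L" and bij: "bij L" and x: "x \<in> unitary_part L" "x \<noteq> 0"
    and recurrent: "\<And>e. 0 < e \<Longrightarrow> \<exists>n\<ge>1. norm ((L ^^ n) x - x) < e"
  shows "\<not> topological_shadowing L"
proof
  assume "topological_shadowing L"
  define \<epsilon> where "\<epsilon> = norm x / 2"
  have "(\<lambda>_. \<epsilon>) \<in> pos_continuous" using x(2) by (simp add: pos_continuous_def \<epsilon>_def)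
  with \<open>topological_shadowing L\<close> obtain \<delta> where \<delta>: "\<delta> \<in> pos_continuous"
    and trace: "\<And>u. pseudo_orbit L \<delta> u \<Longrightarrow> shadowed L (\<lambda>_. \<epsilon>) u"
    unfolding topological_shadowing_def by fast
  obtain K n where Kn: "0 < K" "0 < n"
    and po: "pseudo_orbit L \<delta> (\<lambda>m. staircase K n m *\<^sub>R int_iterate L m x)"
    using drifting_pseudo_orbit[OF L bij x(1) recurrent \<delta>] by blast
  obtain y where y: "\<And>m. dist (int_iterate L m y) (staircase K n m *\<^sub>R int_iterate L m x) < \<epsilon>"
    using trace[OF po] unfolding shadowed_def by blast
  have pairing: "\<bar>Re (cinner y x) - staircase K n (int j) * (norm x)\<^sup>2\<bar> < \<epsilon> * norm x" for j
  proof -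
    let ?c = "staircase K n (int j)" and ?u = "(L ^^ j) x" and ?w = "(L ^^ j) y"
    have "Re (cinner (?w - ?c *\<^sub>R ?u) ?u) = Re (cinner y x) - ?c * (norm x)\<^sup>2"
      by (simp add: cinner_diff_left cinner_scaleR_left unitary_partD[OF x(1)] Re_cinner_self)
    moreover have "\<bar>Re (cinner (?w - ?c *\<^sub>R ?u) ?u)\<bar> \<le> norm (?w - ?c *\<^sub>R ?u) * norm x"
      using abs_Re_cinner_le[of "?w - ?c *\<^sub>R ?u" ?u] by (simp add: norm_funpow_unitary[OF x(1)])
    moreover have "norm (?w - ?c *\<^sub>R ?u) * norm x < \<epsilon> * norm x"
      using y[of "int j"] x(2) by (simp add: dist_norm int_iterate_of_nat)
    ultimately show ?thesis by linarith
  qed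
  have "staircase K n (int 0) = 1" "staircase K n (int (K * n)) = 2"
    using Kn by (simp_all add: staircase_def)
  with pairing[of 0] pairing[of "K * n"] have "(norm x)\<^sup>2 < 2 * (\<epsilon> * norm x)" by (simp add: abs_less_iff)
  then show False by (simp add: \<epsilon>_def power2_eq_square)
qed

lemma zero_nonwandering:
  assumes "f 0 = 0"
  shows "0 \<in> nonwandering_set f"
  using assms by (force simp: nonwandering_set_def intro!: exI[of _ "1::nat"])

theorem theoremC:
  fixes L :: "'a::complex_hilbert_space \<Rightarrow> 'a"
  assumes "(UNIV :: 'a set) \<noteq> {0}"
    and "bounded_clinear L" and "bij L" and "bounded_clinear (inv L)"
    and "normal_operator L"
    and "topological_shadowing L"
  shows "nonwandering_set L = {0}"
proof -
  note L = assms(2) and normal = assms(5)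
  interpret L: bounded_linear L using L by (simp add: bounded_clinear_def)
  have "x = 0" if x: "x \<in> nonwandering_set L" for x
  proof (rule ccontr)
    assume "x \<noteq> 0"
    have unitary: "x \<in> unitary_part L"
      by (intro mem_unitary_part L normal nonwandering_imp_adjoint_comp_fixes x)
    have "\<exists>n\<ge>1. norm ((L ^^ n) x - x) < e" if "0 < e" for e
      using nonwandering_unitary_imp_recurrent[OF x unitary that] by metis
    with no_shadowing_if_recurrent_unitary[OF L assms(3) unitary \<open>x \<noteq> 0\<close>] assms(6)
    show False by blast
  qed
  moreover have "0 \<in> nonwandering_set L" by (rule zero_nonwandering) (rule L.zero)
  ultimately show ?thesis by blast
qed

end
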